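(* Let $\mathcal{F}\subset\binom{[n]}{k}$ be a $t$-intersecting family. If $n\geq 2(t+3)^2k^2$, then $\beta(\mathcal{F})\leq \binom{n-t-3}{k-t-2}$.
   Context: $\binom{[n]}{k}$ denotes the family of all $k$-element subsets of $[n]=\{1,\dots,n\}$. A family is $t$-intersecting if $|F\cap F'|\geq t$ for all members $F,F'$. For a family $\mathcal{F}$ of subsets of $[n]$ and distinct $i,j\in[n]$, let $b_{ij}(\mathcal{F})=|\{F\in\mathcal{F}\colon i\in F,\ j\notin F\}|$; the sturdiness is $\beta(\mathcal{F})=\min_{1\leq i\neq j\leq n} b_{ij}(\mathcal{F})$. Binomial coefficients with negative lower index are $0$.
   Formalization: It is assumed that t ≥ 1, since for t = 0 the claim fails (k = 1, n ≥ 18, all singletons: sturdiness 1, bound 0), and that n ≥ 2, so that the minimum defining β is over a non-empty set. *)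

theory Defs
  imports Main
begin

definition k_subsets :: "nat \<Rightarrow> nat \<Rightarrow> nat set set" where
  "k_subsets n k = {A. A \<subseteq> {1..n} \<and> card A = k}"

definition t_intersecting :: "nat \<Rightarrow> nat set set \<Rightarrow> bool" where
  "t_intersecting t \<F> \<longleftrightarrow> (\<forall>A\<in>\<F>. \<forall>B\<in>\<F>. t \<le> card (A \<inter> B))"

definition b_count :: "nat set set \<Rightarrow> nat \<Rightarrow> nat \<Rightarrow> nat" where
  "b_count \<F> i j = card {A \<in> \<F>. i \<in> A \<and> j \<notin> A}"

(* For n < 2 there are no pairs i \<noteq> j, so the minimum is meaningful only for n \<ge> 2. *)
definition sturdiness :: "nat \<Rightarrow> nat set set \<Rightarrow> nat" where
  "sturdiness n \<F> = Min {b_count \<F> i j | i j. i \<in> {1..n} \<and> j \<in> {1..n} \<and> i \<noteq> j}"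

(* Integer arguments, because truncated subtraction in the lower index would turn
   a negative index into 0 and hence the coefficient into 1. Only m \<ge> 0 is intended. *)
definition binom :: "int \<Rightarrow> int \<Rightarrow> nat" where
  "binom m r = (if r < 0 then 0 else nat m choose nat r)"

end

(* Enlarge the family to a maximal t-intersecting family of sets of size at most i, split off its
   inclusion-minimal members of size exactly i, and continue with i - 1, starting at i = k. A set
   split off at level i meets every member of the current family in at least t points, while each
   of its proper subsets fails to do so; branching therefore bounds the number of such sets by
   (i choose t) (i - t + 1)^(i - t). Branching inside the original k-uniform family would instead
   cost a factor k per step, too much when n is only quadratic in k.

   What survives at i = t + 1 either has a common element j, or consists of (t+1)-subsets of a
   (t+2)-set D. If every member of the family meets D in at least t + 1 points, then b_ij with i
   outside D and j in D is small enough. Otherwise some j in D is avoided only by sets that contain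
   one of k sets of size t + 2 or a set split off earlier. In the cases where such a j exists, few
   members avoid j, and averaging b_ij over i gains the factor k/n that is needed. *)

theory Submission
  imports Defs Complex_Main
begin

section \<open>Counting minimal sets by branching\<close>

lemma card_supersets_le:
  fixes V Z :: "'a set"
  assumes "finite V" "Z \<subseteq> V"
  shows "card {A. A \<subseteq> V \<and> card A = k \<and> Z \<subseteq> A} \<le> (card V - card Z) choose (k - card Z)"
proof -
  have fZ: "finite Z" using assms finite_subset by blast
  have "card {A. A \<subseteq> V \<and> card A = k \<and> Z \<subseteq> A} \<le> card {B. B \<subseteq> V - Z \<and> card B = k - card Z}"
  proof (rule card_inj_on_le[where f = "\<lambda>A. A - Z"])
    show "inj_on (\<lambda>A. A - Z) {A. A \<subseteq> V \<and> card A = k \<and> Z \<subseteq> A}"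
      by (auto simp: inj_on_def)
    show "(\<lambda>A. A - Z) ` {A. A \<subseteq> V \<and> card A = k \<and> Z \<subseteq> A} \<subseteq> {B. B \<subseteq> V - Z \<and> card B = k - card Z}"
      using fZ by (auto simp: card_Diff_subset)
    show "finite {B. B \<subseteq> V - Z \<and> card B = k - card Z}"
      using assms by simp
  qed
  also have "\<dots> = card (V - Z) choose (k - card Z)"
    using assms by (simp add: n_subsets)
  also have "card (V - Z) = card V - card Z"
    using assms fZ by (simp add: card_Diff_subset)
  finally show ?thesis .
qed

text \<open>Induction on the number of points still to be added to \<open>Z\<close>. If
  \<open>Z\<close> lies properly below some member of \<open>W\<close>, minimality yields
  \<open>Y\<close> in \<open>T\<close> meeting \<open>Z\<close> in fewer than \<open>t\<close>
  points, so every member of \<open>W\<close> above \<open>Z\<close> needs a new point of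
  \<open>Y\<close>. Branching over that point adds one element to \<open>Z\<close>.\<close>

lemma card_minimal_branch:
  fixes T W :: "'a set set"
  assumes finW: "finite W"
    and T: "\<And>Y. Y \<in> T \<Longrightarrow> finite Y \<and> card Y \<le> i"
    and W: "\<And>X. X \<in> W \<Longrightarrow> finite X \<and> card X = i"
    and inter: "\<And>X Y. X \<in> W \<Longrightarrow> Y \<in> T \<Longrightarrow> t \<le> card (X \<inter> Y)"
    and minimal: "\<And>X Z. X \<in> W \<Longrightarrow> Z \<subset> X \<Longrightarrow> t \<le> card Z \<Longrightarrow> \<exists>Y\<in>T. card (Y \<inter> Z) < t"
    and "t \<le> i"
  shows "finite Z \<Longrightarrow> t \<le> card Z \<Longrightarrow> card {X \<in> W. Z \<subseteq> X} \<le> (i - t + 1) ^ (i - card Z)"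
proof (induction "i - card Z" arbitrary: Z)
  case 0
  have "X = Z" if "X \<in> W" "Z \<subseteq> X" for X
    using W[OF that(1)] that(2) 0 by (metis card_seteq diff_is_0_eq)
  then have "{X \<in> W. Z \<subseteq> X} \<subseteq> {Z}" by auto
  then have "card {X \<in> W. Z \<subseteq> X} \<le> card {Z}" by (intro card_mono) auto
  then show ?case using 0 by simp
next
  case (Suc m)
  show ?case
  proof (cases "{X \<in> W. Z \<subseteq> X} = {}")
    case True
    then show ?thesis by (metis card.empty le0)
  next
    case False
    then obtain X0 where X0: "X0 \<in> W" "Z \<subseteq> X0" by auto
    with W[OF X0(1)] Suc have "Z \<subset> X0" by auto
    then obtain Y where Y: "Y \<in> T" "card (Y \<inter> Z) < t"
      using minimal[OF X0(1)] Suc by blast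
    \<comment> \<open>Not all of \<open>Y - Z\<close> has to be tried: as \<open>Y\<close> has at
      most \<open>i\<close> points, a set that misses \<open>i - t + 1\<close> of them meets
      \<open>Y\<close> in at most \<open>t - 1\<close>. This keeps the branching factor independent
      of \<open>card Z\<close>.\<close>
    define c where "c = min (i - t + 1) (card (Y - Z))"
    obtain D where D: "D \<subseteq> Y - Z" "card D = c"
      by (metis c_def min.cobounded2 obtain_subset_with_card_n)
    have fD: "finite D" using D T[OF Y(1)] finite_subset by blast
    have hit: "X \<inter> D \<noteq> {}" if X: "X \<in> W" for X
    proof
      assume e: "X \<inter> D = {}"
      show False
      proof (cases "c = card (Y - Z)")
        case True
        then have "D = Y - Z" using D T[OF Y(1)] by (metis card_subset_eq finite_Diff)
        with e have "X \<inter> Y \<subseteq> Y \<inter> Z" by auto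
        then have "card (X \<inter> Y) \<le> card (Y \<inter> Z)"
          using T[OF Y(1)] by (intro card_mono) auto
        then show False using inter[OF X Y(1)] Y(2) by simp
      next
        case False
        then have c: "c = i - t + 1" by (auto simp: c_def min_def split: if_splits)
        have "card (X \<inter> Y) \<le> card (Y - D)"
          using e T[OF Y(1)] by (intro card_mono) auto
        also have "\<dots> = card Y - card D" using fD D by (intro card_Diff_subset) auto
        \<comment> \<open>\<open>Y(2)\<close> enters to give \<open>0 < t\<close>, so that
          \<open>i - (i - t + 1)\<close> is really below \<open>t\<close>.\<close>
        finally show False using inter[OF X Y(1)] T[OF Y(1)] c D(2) \<open>t \<le> i\<close> Y(2) by linarith
      qed
    qed
    have step: "card {X \<in> W. insert d Z \<subseteq> X} \<le> (i - t + 1) ^ m" if d: "d \<in> D" for d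
    proof -
      have "d \<notin> Z" using d D by auto
      then have cd: "card (insert d Z) = Suc (card Z)" using Suc by simp
      have m: "m = i - card (insert d Z)" using Suc.hyps(2) cd by linarith
      show ?thesis
        using Suc.hyps(1)[OF m] Suc.prems cd m by simp
    qed
    have "{X \<in> W. Z \<subseteq> X} \<subseteq> (\<Union>d\<in>D. {X \<in> W. insert d Z \<subseteq> X})"
      using hit by fastforce
    then have "card {X \<in> W. Z \<subseteq> X} \<le> card (\<Union>d\<in>D. {X \<in> W. insert d Z \<subseteq> X})"
      using finW fD by (intro card_mono) auto
    also have "\<dots> \<le> (\<Sum>d\<in>D. card {X \<in> W. insert d Z \<subseteq> X})"
      by (rule card_UN_le[OF fD])
    also have "\<dots> \<le> (\<Sum>d\<in>D. (i - t + 1) ^ m)" by (rule sum_mono[OF step])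
    also have "\<dots> \<le> (i - t + 1) * (i - t + 1) ^ m"
      using D(2) by (simp add: c_def del: One_nat_def)
    also have "\<dots> = (i - t + 1) ^ (i - card Z)" by (simp flip: Suc.hyps(2))
    finally show ?thesis .
  qed
qed

text \<open>All members of \<open>W\<close> share at least \<open>t\<close> points with one fixed
  member \<open>Y\<close>. The \<open>t\<close>-subsets of \<open>Y\<close> are the
  \<open>i choose t\<close> starting points, and each leaves \<open>i - t\<close> branching
  steps.\<close>

lemma card_minimal_le:
  fixes T W :: "'a set set"
  assumes finW: "finite W" and sub: "W \<subseteq> T"
    and T: "\<And>Y. Y \<in> T \<Longrightarrow> finite Y \<and> card Y \<le> i"
    and W: "\<And>X. X \<in> W \<Longrightarrow> card X = i"
    and inter: "\<And>X Y. X \<in> W \<Longrightarrow> Y \<in> T \<Longrightarrow> t \<le> card (X \<inter> Y)"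
    and minimal: "\<And>X Z. X \<in> W \<Longrightarrow> Z \<subset> X \<Longrightarrow> t \<le> card Z \<Longrightarrow> \<exists>Y\<in>T. card (Y \<inter> Z) < t"
  shows "card W \<le> (i choose t) * (i - t + 1) ^ (i - t)"
proof (cases "W = {}")
  case False
  then obtain Y where Y: "Y \<in> W" by blast
  then have fY: "finite Y" and cY: "card Y = i" using T W sub by auto
  have "t \<le> i" using inter[OF Y, of Y] Y sub cY by auto
  define P where "P = {Z. Z \<subseteq> Y \<and> card Z = t}"
  have fP: "finite P" using fY by (simp add: P_def)
  have "W \<subseteq> (\<Union>Z\<in>P. {X \<in> W. Z \<subseteq> X})"
  proof
    fix X assume X: "X \<in> W"
    then have "t \<le> card (X \<inter> Y)" using inter Y sub by blast
    then obtain Z where "Z \<subseteq> X \<inter> Y" "card Z = t" by (rule obtain_subset_with_card_n)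
    then show "X \<in> (\<Union>Z\<in>P. {X \<in> W. Z \<subseteq> X})" using X by (auto simp: P_def)
  qed
  then have "card W \<le> card (\<Union>Z\<in>P. {X \<in> W. Z \<subseteq> X})"
    using finW fP by (intro card_mono) auto
  also have "\<dots> \<le> (\<Sum>Z\<in>P. card {X \<in> W. Z \<subseteq> X})" by (rule card_UN_le[OF fP])
  also have "\<dots> \<le> (\<Sum>Z\<in>P. (i - t + 1) ^ (i - t))"
  proof (rule sum_mono)
    fix Z assume Z: "Z \<in> P"
    then have Zt: "finite Z" "card Z = t" using fY finite_subset by (auto simp: P_def)
    have "card {X \<in> W. Z \<subseteq> X} \<le> (i - t + 1) ^ (i - card Z)"
    proof (rule card_minimal_branch[OF finW])
      show "finite X \<and> card X = i" if "X \<in> W" for X using that T W sub by blast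
    qed (use T inter minimal \<open>t \<le> i\<close> Zt in simp_all)
    then show "card {X \<in> W. Z \<subseteq> X} \<le> (i - t + 1) ^ (i - t)" using Zt by simp
  qed
  also have "\<dots> = (i choose t) * (i - t + 1) ^ (i - t)"
    using fY cY by (simp add: P_def n_subsets)
  finally show ?thesis .
qed simp

section \<open>Splitting off minimal sets level by level\<close>

text \<open>\<open>W\<close> collects the sets split off at the levels above \<open>l\<close>, and
  \<open>T\<close> is what survives. The family is enlarged to a maximal one anew at every level,
  since maximality supplies the hypothesis \<open>minimal\<close> of the branching bound.\<close>

lemma t_intersecting_descent:
  assumes "finite V" "S \<subseteq> Pow V" "t_intersecting t S"
    and "\<And>X. X \<in> S \<Longrightarrow> card X \<le> l + d"
  shows "\<exists>T W. T \<subseteq> Pow V \<and> t_intersecting t T \<and> (\<forall>X\<in>T. card X \<le> l) \<and>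
    W \<subseteq> Pow V \<and> (\<forall>X\<in>W. l < card X \<and> card X \<le> l + d) \<and>
    (\<forall>i. card {X \<in> W. card X = i} \<le> (i choose t) * (i - t + 1) ^ (i - t)) \<and>
    (\<forall>X\<in>S. \<exists>Y\<in>T \<union> W. Y \<subseteq> X)"
  using assms(2-)
proof (induction d arbitrary: S)
  case 0
  then show ?case by (intro exI[of _ S] exI[of _ "{}"]) auto
next
  case (Suc d)
  let ?i = "l + Suc d"
  define \<T> where "\<T> = {T. T \<subseteq> {X \<in> Pow V. card X \<le> ?i} \<and> t_intersecting t T}"
  have "finite \<T>" using assms(1) by (simp add: \<T>_def)
  moreover have "S \<in> \<T>" using Suc.prems by (auto simp: \<T>_def)
  ultimately obtain T where T: "T \<in> \<T>" "S \<subseteq> T" and max: "\<And>T'. T' \<in> \<T> \<Longrightarrow> T \<subseteq> T' \<Longrightarrow> T = T'"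
    using finite_has_maximal2[of \<T> S] by auto
  have TV: "T \<subseteq> Pow V" and Tint: "t_intersecting t T" and Tc: "\<And>X. X \<in> T \<Longrightarrow> card X \<le> ?i"
    using T by (auto simp: \<T>_def)
  have finT: "\<And>X. X \<in> T \<Longrightarrow> finite X" using TV assms(1) finite_subset by blast
  define U where "U = {X \<in> T. card X = ?i \<and> (\<forall>Z\<in>T. \<not> Z \<subset> X)}"
  define R where "R = {X \<in> T. card X \<le> l + d}"
  have Ucard: "card U \<le> (?i choose t) * (?i - t + 1) ^ (?i - t)"
  proof (rule card_minimal_le)
    show "finite U" using TV assms(1) by (auto simp: U_def intro: finite_subset)
    show "U \<subseteq> T" by (auto simp: U_def)
    show "finite Y \<and> card Y \<le> ?i" if "Y \<in> T" for Y using that finT Tc by blast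
    show "card X = ?i" if "X \<in> U" for X using that by (simp add: U_def)
    show "t \<le> card (X \<inter> Y)" if "X \<in> U" "Y \<in> T" for X Y
      using that Tint by (auto simp: U_def t_intersecting_def)
    show "\<exists>Y\<in>T. card (Y \<inter> Z) < t" if X: "X \<in> U" and Z: "Z \<subset> X" "t \<le> card Z" for X Z
    proof (rule ccontr)
      assume "\<not> ?thesis"
      then have *: "\<And>Y. Y \<in> T \<Longrightarrow> t \<le> card (Y \<inter> Z)" by (meson not_less)
      have XT: "X \<in> T" using X by (simp add: U_def)
      \<comment> \<open>A proper subset \<open>Z\<close> that meets every member in \<open>t\<close>
        points could be added to \<open>T\<close>. By maximality it is already there, so
        \<open>X\<close> is not minimal.\<close>
      have "card Z \<le> card X" using Z finT[OF XT] by (intro card_mono) auto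
      then have "insert Z T \<in> \<T>"
        using * Z XT TV Tc Tint
        by (fastforce simp: \<T>_def t_intersecting_def Int_commute)
      then have "Z \<in> T" using max[of "insert Z T"] by blast
      then show False using X Z by (simp add: U_def)
    qed
  qed
  have "R \<subseteq> Pow V" "t_intersecting t R" "\<And>X. X \<in> R \<Longrightarrow> card X \<le> l + d"
    using TV Tint by (auto simp: R_def t_intersecting_def)
  from Suc.IH[OF this] obtain T' W where
    W: "T' \<subseteq> Pow V" "t_intersecting t T'" "\<forall>X\<in>T'. card X \<le> l" "W \<subseteq> Pow V"
    "\<forall>X\<in>W. l < card X \<and> card X \<le> l + d"
    "\<forall>i. card {X \<in> W. card X = i} \<le> (i choose t) * (i - t + 1) ^ (i - t)"
    "\<forall>X\<in>R. \<exists>Y\<in>T' \<union> W. Y \<subseteq> X"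
    by blast
  have layers: "card {X \<in> W \<union> U. card X = i} \<le> (i choose t) * (i - t + 1) ^ (i - t)" for i
  proof (cases "i = ?i")
    case True
    then have "{X \<in> W \<union> U. card X = i} = U" using W(5) by (fastforce simp: U_def)
    then show ?thesis using Ucard True by simp
  next
    case False
    then have "{X \<in> W \<union> U. card X = i} = {X \<in> W. card X = i}" by (auto simp: U_def)
    then show ?thesis using W(6) by simp
  qed
  have cover: "\<exists>Y\<in>T' \<union> (W \<union> U). Y \<subseteq> X" if "X \<in> S" for X
  proof -
    have XT: "X \<in> T" using that T by blast
    have sm: "\<exists>Y\<in>T' \<union> (W \<union> U). Y \<subseteq> X" if "Z \<in> T" "Z \<subseteq> X" "card Z \<le> l + d" for Z
    proof -
      have "Z \<in> R" using that by (simp add: R_def)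
      then obtain Y where "Y \<in> T' \<union> W" "Y \<subseteq> Z" using W(7) by metis
      then show ?thesis using that(2) by (intro bexI[of _ Y]) auto
    qed
    consider "card X \<le> l + d" | "card X = ?i" using Tc[OF XT] by fastforce
    then show ?thesis
    proof cases
      case 1
      then show ?thesis using sm[OF XT] by blast
    next
      case 2
      show ?thesis
      proof (cases "X \<in> U")
        case False
        then obtain Z where Z: "Z \<in> T" "Z \<subset> X" using 2 XT by (auto simp: U_def)
        then have "card Z < card X" using finT[OF XT] by (intro psubset_card_mono)
        then show ?thesis using sm[OF Z(1)] Z 2 by auto
      qed blast
    qed
  qed
  show ?case
  proof (rule exI[of _ T'], rule exI[of _ "W \<union> U"], intro conjI)
    show "W \<union> U \<subseteq> Pow V" using W(4) TV by (auto simp: U_def)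
    show "\<forall>X\<in>W \<union> U. l < card X \<and> card X \<le> l + Suc d"
      using W(5) by (auto simp: U_def)
    show "\<forall>i. card {X \<in> W \<union> U. card X = i} \<le> (i choose t) * (i - t + 1) ^ (i - t)"
      using layers by blast
    show "\<forall>X\<in>S. \<exists>Y\<in>T' \<union> (W \<union> U). Y \<subseteq> X" using cover by blast
  qed (use W in auto)
qed

section \<open>Structure of families of sets of size at most t + 1\<close>

text \<open>A member of size \<open>t\<close> lies in all others. If all members have size
  \<open>t + 1\<close>, two of them share a \<open>t\<close>-set \<open>C\<close>, and either
  \<open>C\<close> lies in every member or all members lie in the union of the two.\<close>

lemma t_intersecting_small_sets:
  assumes "finite V" "V \<noteq> {}" "T \<subseteq> Pow V" "t_intersecting t T" "1 \<le> t"
    and small: "\<And>X. X \<in> T \<Longrightarrow> card X \<le> t + 1"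
  shows "(\<exists>j\<in>V. \<forall>X\<in>T. j \<in> X) \<or>
    (\<exists>D. D \<subseteq> V \<and> card D = t + 2 \<and> (\<forall>X\<in>T. t + 1 \<le> card (X \<inter> D)))"
proof -
  have fin: "\<And>X. X \<in> T \<Longrightarrow> finite X" using assms(1,3) finite_subset by blast
  have int: "\<And>X Y. X \<in> T \<Longrightarrow> Y \<in> T \<Longrightarrow> t \<le> card (X \<inter> Y)"
    using assms(4) by (simp add: t_intersecting_def)
  have common: ?thesis if "C \<noteq> {}" "C \<subseteq> V" "\<And>X. X \<in> T \<Longrightarrow> C \<subseteq> X" for C
    using that by blast
  consider "T = {}" | X where "X \<in> T" "card X \<le> t" | A where "T = {A}"
    | A B where "A \<in> T" "B \<in> T" "A \<noteq> B" "\<forall>X\<in>T. t < card X"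
    by (cases "T = {}") (blast, metis insertI1 insert_absorb is_singletonI' is_singleton_def not_le singletonD)
  then show ?thesis
  proof cases
    case 1
    then show ?thesis using assms(2) by blast
  next
    case 2
    show ?thesis
    proof (rule common[of X])
      show "X \<noteq> {}" using int[OF 2(1) 2(1)] assms(5) by auto
      show "X \<subseteq> V" using 2 assms(3) by blast
      show "X \<subseteq> Y" if "Y \<in> T" for Y
      proof -
        have "card X \<le> card (X \<inter> Y)" using int[OF 2(1) that] 2(2) by simp
        then have "X \<inter> Y = X" using fin[OF 2(1)] by (metis Int_lower1 card_seteq)
        then show ?thesis by blast
      qed
    qed
  next
    case 3
    show ?thesis
      using 3 int[of A A] assms(3,5) by (intro common[of A]) auto
  next
    case 4
    have c: "card X = t + 1" if "X \<in> T" for X using 4(4) small that by fastforce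
    define C where "C = A \<inter> B"
    have fA: "finite A" and fB: "finite B" using fin 4 by auto
    have "C \<noteq> A" "C \<noteq> B"
      using card_subset_eq[OF fB, of A] card_subset_eq[OF fA, of B] c 4 by (auto simp: C_def)
    then have "card C < card A" using fA by (intro psubset_card_mono) (auto simp: C_def)
    then have cC: "card C = t" using int[OF 4(1,2)] c[OF 4(1)] by (simp add: C_def)
    have cAB: "card (A \<union> B) = t + 2"
      using card_Un_Int[OF fA fB] c 4(1,2) cC by (simp add: C_def)
    \<comment> \<open>Without \<open>x\<close>, the set \<open>X\<close> can reach \<open>t\<close>
      common points with \<open>A\<close> and with \<open>B\<close> only by containing the rest of
      both. These \<open>t + 1\<close> points exhaust \<open>X\<close>.\<close>
    have miss: "A \<union> B - {x} \<subseteq> X \<and> X \<subseteq> A \<union> B" if X: "X \<in> T" and x: "x \<in> C" "x \<notin> X" for X x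
    proof -
      have one: "Y - {x} \<subseteq> X" if Y: "Y \<in> T" "x \<in> Y" for Y
      proof -
        have "card (Y - {x}) = t" using c[OF Y(1)] Y fin by simp
        moreover have "X \<inter> Y \<subseteq> Y - {x}" using x by auto
        ultimately have "X \<inter> Y = Y - {x}"
          using int[OF X Y(1)] fin[OF Y(1)] by (metis card_seteq finite_Diff)
        then show ?thesis by blast
      qed
      have *: "A \<union> B - {x} \<subseteq> X" using one[OF 4(1)] one[OF 4(2)] x by (auto simp: C_def)
      have "card (A \<union> B - {x}) = t + 1" using cAB x fA fB by (simp add: C_def)
      then have "A \<union> B - {x} = X" using * c[OF X] fin[OF X] by (metis card_subset_eq)
      then show ?thesis by blast
    qed
    show ?thesis
    proof (cases "\<forall>X\<in>T. C \<subseteq> X")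
      case True
      then show ?thesis using cC assms(3,5) 4(1) by (intro common[of C]) (auto simp: C_def)
    next
      case False
      then obtain G x where G: "G \<in> T" "x \<in> C" "x \<notin> G" by blast
      have "X \<subseteq> A \<union> B" if X: "X \<in> T" for X
      proof (rule ccontr)
        assume n: "\<not> X \<subseteq> A \<union> B"
        then have CX: "C \<subseteq> X" using miss[OF X] by blast
        obtain e where e: "e \<in> X" "e \<notin> A \<union> B" using n by blast
        \<comment> \<open>A member with a point \<open>e\<close> outside \<open>A \<union> B\<close>
          must be \<open>insert e C\<close>, and it then meets \<open>G\<close> only in
          \<open>C - {x}\<close>, which has \<open>t - 1\<close> points.\<close>
        have "insert e C \<subseteq> X" using e CX by blast
        moreover have "card (insert e C) = t + 1" using cC e fA by (simp add: C_def)
        ultimately have "X = insert e C" using c[OF X] fin[OF X] by (metis card_subset_eq)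
        then have "X \<inter> G \<subseteq> C - {x}" using e miss[OF G] G by blast
        then have "card (X \<inter> G) \<le> card (C - {x})" using fA by (intro card_mono) (auto simp: C_def)
        then show False using int[OF X G(1)] cC G(2) fA assms(5) by (simp add: C_def)
      qed
      then have "t + 1 \<le> card (X \<inter> (A \<union> B))" if "X \<in> T" for X
        using c that by (metis inf.absorb1 order_refl)
      then show ?thesis using cAB 4 assms(3) by (intro disjI2 exI[of _ "A \<union> B"]) auto
    qed
  qed
qed

section \<open>Numerical estimates for the level weights\<close>

text \<open>This is \<open>(1 + 1/m)^m \<le> e\<close>, with \<open>e\<close> rounded up to
  4.\<close>

lemma power_Suc_base_le: "(Suc m) ^ m \<le> 4 * m ^ m"
proof (cases "m = 0")
  case False
  have "(1 + 1 / real m) ^ m \<le> exp 1"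
    using exp_ge_one_plus_x_over_n_power_n[of m 1] False by simp
  also have "\<dots> \<le> 4" using exp_le by simp
  finally have "(1 + 1 / real m) ^ m * real m ^ m \<le> 4 * real m ^ m"
    by (intro mult_right_mono) auto
  also have "(1 + 1 / real m) ^ m * real m ^ m = (real (Suc m)) ^ m"
    using False by (simp add: power_mult_distrib[symmetric] field_simps)
  finally have "real ((Suc m) ^ m) \<le> real (4 * m ^ m)" by simp
  then show ?thesis by (simp only: of_nat_le_iff)
qed simp

lemma sum_le_geometric:
  fixes f :: "nat \<Rightarrow> nat"
  assumes "a \<le> b" and step: "\<And>i. a \<le> i \<Longrightarrow> i < b \<Longrightarrow> 4 * f (Suc i) \<le> f i"
  shows "3 * sum f {a..b} \<le> 4 * f a"
proof -
  \<comment> \<open>The extra \<open>f b\<close> strengthens the induction: it pays for the four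
    copies of the next term.\<close>
  have "3 * sum f {a..b} + f b \<le> 4 * f a"
    using assms
  proof (induction b rule: dec_induct)
    case (step b)
    have "4 * f (Suc b) \<le> f b" using step by simp
    moreover have "3 * sum f {a..b} + f b \<le> 4 * f a" using step by simp
    moreover have "sum f {a..Suc b} = sum f {a..b} + f (Suc b)" using step by simp
    ultimately show ?case by linarith
  qed simp
  then show ?thesis by simp
qed

text \<open>With \<open>N\<close> and \<open>K\<close> as in the proof, the ratio of consecutive
  weights is at most \<open>4 * (t + r + 1) * K / N\<close>, hence at most
  \<open>4 * k\<^sup>2 / N\<close>. The hypothesis has 17 rather than 16 because \<open>N\<close> is
  smaller than \<open>n\<close> by up to \<open>k\<close>.\<close>

lemma level_weight_step:
  fixes n k t r :: nat
  assumes "t + r < k" "17 * k\<^sup>2 \<le> n"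
  shows "4 * ((t + Suc r choose t) * (Suc r + 1) ^ Suc r * ((n - (t + Suc r)) choose (k - (t + Suc r))))
    \<le> (t + r choose t) * (r + 1) ^ r * ((n - (t + r)) choose (k - (t + r)))"
proof -
  define N K where "N = n - (t + r)" and "K = k - (t + r)"
  have kk: "k \<le> k\<^sup>2" by (simp add: power2_eq_square)
  have "16 * k\<^sup>2 + k \<le> n" using kk assms(2) by linarith
  then have N: "16 * k\<^sup>2 \<le> N" "0 < N" "0 < K" "K \<le> k"
    using assms(1) by (auto simp: N_def K_def)
  have b1: "Suc r * (t + Suc r choose t) = (t + Suc r) * (t + r choose t)"
    using Suc_times_binomial[of r "t + r"] binomial_symmetric[of t "t + Suc r"]
      binomial_symmetric[of t "t + r"] by simp
  have b2: "N * (N - 1 choose (K - 1)) = K * (N choose K)"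
    using times_binomial_minus1_eq[OF N(3), of N] by simp
  \<comment> \<open>The factor \<open>Suc r * N\<close> clears the denominators of the absorption
    identities \<open>b1\<close> and \<open>b2\<close>. It is cancelled at the end.\<close>
  have "(Suc r * N) * (4 * ((t + Suc r choose t) * (Suc r + 1) ^ Suc r * (N - 1 choose (K - 1))))
      = 4 * (Suc r * (t + Suc r choose t)) * (Suc (Suc r)) ^ Suc r * (N * (N - 1 choose (K - 1)))"
    by (simp only: mult_ac Suc_eq_plus1)
  also have "\<dots> = 4 * ((t + Suc r) * (t + r choose t)) * (Suc (Suc r)) ^ Suc r * (K * (N choose K))"
    by (simp only: b1 b2)
  also have "\<dots> \<le> 4 * (k * (t + r choose t)) * (4 * Suc r ^ Suc r) * (k * (N choose K))"
    using assms(1) N(4) power_Suc_base_le[of "Suc r"] by (intro mult_mono order_refl) simp_all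
  also have "\<dots> = (16 * k\<^sup>2) * (Suc r * ((t + r choose t) * Suc r ^ r * (N choose K)))"
    by (simp add: power2_eq_square del: mult_Suc)
  also have "\<dots> \<le> N * (Suc r * ((t + r choose t) * Suc r ^ r * (N choose K)))"
    using N(1) by (rule mult_right_mono) simp
  also have "\<dots> = (Suc r * N) * ((t + r choose t) * (r + 1) ^ r * (N choose K))"
    by (simp only: mult_ac Suc_eq_plus1)
  finally have "4 * ((t + Suc r choose t) * (Suc r + 1) ^ Suc r * (N - 1 choose (K - 1)))
    \<le> (t + r choose t) * (r + 1) ^ r * (N choose K)"
    by (rule mult_left_le_imp_le) (use N(2) in simp)
  then show ?thesis by (simp add: N_def K_def)
qed

text \<open>The weights decay geometrically, so the sum is at most 4/3 of its first term, which is
  \<open>9 * (t + 2 choose 2) * C\<close>. One factor \<open>t + 2\<close> is then bounded by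
  \<open>k\<close>, and \<open>6 * (t + 1)\<close> by \<open>(t + 3)\<^sup>2\<close>.\<close>

lemma level_weight_sum_le:
  fixes n k t :: nat
  assumes "t + 2 \<le> k" "2 * (t + 3)\<^sup>2 * k\<^sup>2 \<le> n"
  shows "2 * k * (\<Sum>i = t + 2..k. (i choose t) * (i - t + 1) ^ (i - t) * ((n - i) choose (k - i)))
    \<le> n * ((n - (t + 2)) choose (k - (t + 2)))"
proof -
  define f where "f i = (i choose t) * (i - t + 1) ^ (i - t) * ((n - i) choose (k - i))" for i
  define C where "C = (n - (t + 2)) choose (k - (t + 2))"
  have "9 \<le> (t + 3)\<^sup>2" by (simp add: power2_sum)
  then have "18 * k\<^sup>2 \<le> n"
    using assms(2) mult_right_mono[of 18 "2 * (t + 3)\<^sup>2" "k\<^sup>2"] by linarith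
  then have "17 * k\<^sup>2 \<le> n" by linarith
  have "3 * sum f {t + 2..k} \<le> 4 * f (t + 2)"
  proof (rule sum_le_geometric[OF assms(1)])
    fix i assume i: "t + 2 \<le> i" "i < k"
    then obtain r where r: "i = t + r" by (metis add.assoc le_Suc_ex)
    show "4 * f (Suc i) \<le> f i"
      using level_weight_step[of t r k n] i r \<open>17 * k\<^sup>2 \<le> n\<close> by (simp add: f_def)
  qed
  moreover have "2 * f (t + 2) = 9 * ((t + 2) * (t + 1)) * C"
  proof -
    have "2 * (t + 2 choose t) = (t + 2) * (t + 1)"
      using binomial_symmetric[of t "t + 2"] by (simp add: choose_two)
    then show ?thesis by (simp add: f_def C_def)
  qed
  ultimately have "sum f {t + 2..k} \<le> 6 * ((t + 2) * (t + 1)) * C" by linarith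
  then have "2 * k * sum f {t + 2..k} \<le> 2 * k * (6 * ((t + 2) * (t + 1)) * C)"
    by (rule mult_left_mono) simp
  also have "\<dots> = 2 * k * (t + 2) * (6 * (t + 1)) * C" by (simp only: mult_ac)
  also have "\<dots> \<le> 2 * k * k * (t + 3)\<^sup>2 * C"
  proof (rule mult_right_mono[OF mult_le_mono])
    show "2 * k * (t + 2) \<le> 2 * k * k" by (rule mult_left_mono[OF assms(1)]) simp
    show "6 * (t + 1) \<le> (t + 3)\<^sup>2" by (simp add: power2_sum)
  qed simp
  also have "\<dots> \<le> n * C"
  proof (rule mult_right_mono)
    have "2 * k * k * (t + 3)\<^sup>2 = 2 * (t + 3)\<^sup>2 * k\<^sup>2" by (simp add: power2_eq_square)
    then show "2 * k * k * (t + 3)\<^sup>2 \<le> n" using assms(2) by linarith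
  qed simp
  finally show ?thesis unfolding f_def C_def .
qed

section \<open>Union bound and averaging\<close>

lemma card_covered_le:
  assumes "W \<subseteq> Pow {1..n}" "\<And>Y. Y \<in> W \<Longrightarrow> l \<le> card Y"
    and "\<And>i. card {Y \<in> W. card Y = i} \<le> w i"
  shows "card {A \<in> k_subsets n k. \<exists>Y\<in>W. Y \<subseteq> A} \<le> (\<Sum>i = l..k. w i * ((n - i) choose (k - i)))"
proof -
  define L where "L i = {Y \<in> W. card Y = i}" for i
  define G where "G Y = {A. A \<subseteq> {1..n} \<and> card A = k \<and> Y \<subseteq> A}" for Y
  have finL: "finite (L i)" for i
    using assms(1) by (auto simp: L_def intro: finite_subset)
  have finG: "finite (G Y)" for Y by (simp add: G_def)
  have "{A \<in> k_subsets n k. \<exists>Y\<in>W. Y \<subseteq> A} \<subseteq> (\<Union>i\<in>{l..k}. \<Union>Y\<in>L i. G Y)"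
  proof
    fix A assume "A \<in> {A \<in> k_subsets n k. \<exists>Y\<in>W. Y \<subseteq> A}"
    then obtain Y where Y: "A \<subseteq> {1..n}" "card A = k" "Y \<in> W" "Y \<subseteq> A"
      by (auto simp: k_subsets_def)
    then have "card Y \<le> k" by (metis card_mono finite_atLeastAtMost finite_subset)
    then have "card Y \<in> {l..k}" using assms(2) Y by auto
    moreover have "Y \<in> L (card Y)" "A \<in> G Y" using Y by (auto simp: L_def G_def)
    ultimately show "A \<in> (\<Union>i\<in>{l..k}. \<Union>Y\<in>L i. G Y)" by blast
  qed
  then have "card {A \<in> k_subsets n k. \<exists>Y\<in>W. Y \<subseteq> A} \<le> card (\<Union>i\<in>{l..k}. \<Union>Y\<in>L i. G Y)"
    using finL finG by (intro card_mono) auto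
  also have "\<dots> \<le> (\<Sum>i = l..k. card (\<Union>Y\<in>L i. G Y))" by (rule card_UN_le) simp
  also have "\<dots> \<le> (\<Sum>i = l..k. w i * ((n - i) choose (k - i)))"
  proof (rule sum_mono)
    fix i
    have "card (\<Union>Y\<in>L i. G Y) \<le> (\<Sum>Y\<in>L i. card (G Y))" by (rule card_UN_le[OF finL])
    also have "\<dots> \<le> (\<Sum>Y\<in>L i. (n - i) choose (k - i))"
    proof (rule sum_mono)
      fix Y assume "Y \<in> L i"
      then show "card (G Y) \<le> (n - i) choose (k - i)"
        using card_supersets_le[of "{1..n}" Y k] assms(1) by (auto simp: G_def L_def)
    qed
    also have "\<dots> \<le> w i * ((n - i) choose (k - i))"
      using assms(3)[of i] by (simp add: L_def)
    finally show "card (\<Union>Y\<in>L i. G Y) \<le> w i * ((n - i) choose (k - i))" .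
  qed
  finally show ?thesis .
qed

lemma finite_k_subsets: "finite (k_subsets n k)"
  by (simp add: k_subsets_def)

text \<open>Double counting of pairs of a point and a member avoiding \<open>j\<close>: such a
  member has all its \<open>k\<close> points among the indices of the sum.\<close>

lemma sum_b_count:
  assumes "\<F> \<subseteq> k_subsets n k"
  shows "(\<Sum>i\<in>{1..n} - {j}. b_count \<F> i j) = k * card {A \<in> \<F>. j \<notin> A}"
proof -
  let ?R = "{A \<in> \<F>. j \<notin> A}"
  have fin: "finite ?R" using assms finite_k_subsets by (auto intro: finite_subset)
  have "(\<Sum>i\<in>{1..n} - {j}. b_count \<F> i j) = (\<Sum>i\<in>{1..n} - {j}. card {A \<in> ?R. i \<in> A})"
    unfolding b_count_def by (intro sum.cong refl arg_cong[where f = card]) auto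
  also have "\<dots> = (\<Sum>A\<in>?R. card {i \<in> {1..n} - {j}. i \<in> A})"
    by (rule sum_multicount_gen) (use fin in auto)
  also have "\<dots> = (\<Sum>A\<in>?R. k)"
  proof (rule sum.cong[OF refl])
    fix A assume A: "A \<in> ?R"
    then have "{i \<in> {1..n} - {j}. i \<in> A} = A" "card A = k"
      using assms unfolding k_subsets_def by blast+
    then show "card {i \<in> {1..n} - {j}. i \<in> A} = k" by simp
  qed
  finally show ?thesis by simp
qed

lemma sturdiness_le_b_count:
  assumes "i \<in> {1..n}" "j \<in> {1..n}" "i \<noteq> j"
  shows "sturdiness n \<F> \<le> b_count \<F> i j"
proof -
  let ?B = "{b_count \<F> i j | i j. i \<in> {1..n} \<and> j \<in> {1..n} \<and> i \<noteq> j}"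
  have "?B \<subseteq> (\<lambda>(i, j). b_count \<F> i j) ` ({1..n} \<times> {1..n})" by auto
  then have "finite ?B" by (rule finite_subset) simp
  then show ?thesis unfolding sturdiness_def using assms by (intro Min_le) auto
qed

text \<open>A minimum is at most the average, here over the \<open>n - 1\<close> choices of
  \<open>i\<close>. This is the source of the gain of order \<open>k / n\<close>.\<close>

lemma sturdiness_mult_le:
  assumes "\<F> \<subseteq> k_subsets n k" "j \<in> {1..n}"
  shows "(n - 1) * sturdiness n \<F> \<le> k * card {A \<in> \<F>. j \<notin> A}"
proof -
  have "(n - 1) * sturdiness n \<F> = (\<Sum>i\<in>{1..n} - {j}. sturdiness n \<F>)"
    using assms(2) by simp
  also have "\<dots> \<le> (\<Sum>i\<in>{1..n} - {j}. b_count \<F> i j)"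
    using assms(2) by (intro sum_mono sturdiness_le_b_count) auto
  finally show ?thesis using sum_b_count[OF assms(1)] by simp
qed

section \<open>The dichotomy\<close>

text \<open>The sum bounds the members containing a split-off set, the last summand those containing
  one of at most \<open>k\<close> sets of size \<open>t + 2\<close>. The guard is needed because
  truncated subtraction would turn \<open>k - (t + 2)\<close> into 0 for small
  \<open>k\<close>.\<close>

lemma few_avoiding_or_concentrated:
  assumes "1 \<le> t" "1 \<le> n" "\<F> \<subseteq> k_subsets n k" "t_intersecting t \<F>"
  shows "(\<exists>j\<in>{1..n}. card {A \<in> \<F>. j \<notin> A} \<le>
      (\<Sum>i = t + 2..k. (i choose t) * (i - t + 1) ^ (i - t) * ((n - i) choose (k - i))) +
      (if t + 2 \<le> k then k * ((n - (t + 2)) choose (k - (t + 2))) else 0)) \<or>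
    (\<exists>D. D \<subseteq> {1..n} \<and> card D = t + 2 \<and> (\<forall>A\<in>\<F>. t + 1 \<le> card (A \<inter> D)))"
proof -
  have \<F>: "A \<subseteq> {1..n}" "card A = k" "finite A" if "A \<in> \<F>" for A
    using assms(3) that by (auto simp: k_subsets_def intro: finite_subset)
  have "\<F> \<subseteq> Pow {1..n}" "\<And>X. X \<in> \<F> \<Longrightarrow> card X \<le> t + 1 + (k - (t + 1))"
    using \<F> by auto
  from t_intersecting_descent[OF _ this(1) assms(4) this(2)] obtain T W where
    T: "T \<subseteq> Pow {1..n}" "t_intersecting t T" "\<forall>X\<in>T. card X \<le> t + 1" and
    W: "W \<subseteq> Pow {1..n}" "\<forall>X\<in>W. t + 1 < card X"
      "\<forall>i. card {X \<in> W. card X = i} \<le> (i choose t) * (i - t + 1) ^ (i - t)" and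
    cover: "\<forall>X\<in>\<F>. \<exists>Y\<in>T \<union> W. Y \<subseteq> X"
    by auto
  define H where "H = {A \<in> k_subsets n k. \<exists>Y\<in>W. Y \<subseteq> A}"
  have finH: "finite H" by (simp add: H_def finite_k_subsets)
  have H: "card H \<le> (\<Sum>i = t + 2..k. (i choose t) * (i - t + 1) ^ (i - t) * ((n - i) choose (k - i)))"
    unfolding H_def using W by (intro card_covered_le) auto
  have split: "A \<in> H \<or> (\<exists>Y\<in>T. Y \<subseteq> A)" if "A \<in> \<F>" for A
  proof -
    obtain Y where Y: "Y \<in> T \<union> W" "Y \<subseteq> A" using cover \<open>A \<in> \<F>\<close> by (meson bspec)
    moreover have "A \<in> k_subsets n k" using assms(3) \<open>A \<in> \<F>\<close> by (rule subsetD)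
    ultimately show ?thesis unfolding H_def by (cases "Y \<in> T") auto
  qed
  consider j where "j \<in> {1..n}" "\<forall>X\<in>T. j \<in> X"
    | D where "D \<subseteq> {1..n}" "card D = t + 2" "\<forall>X\<in>T. t + 1 \<le> card (X \<inter> D)"
    using t_intersecting_small_sets[OF _ _ T(1,2) assms(1)] T(3) assms(2) by fastforce
  then show ?thesis
  proof cases
    case 1
    then have "{A \<in> \<F>. j \<notin> A} \<subseteq> H" using split by blast
    then have "card {A \<in> \<F>. j \<notin> A} \<le> card H" using finH by (rule card_mono[rotated])
    then show ?thesis using H 1(1) by (intro disjI1 bexI[of _ j]) linarith+
  next
    case 2
    have fD: "finite D" using 2(1) finite_subset by blast
    show ?thesis
    proof (cases "\<forall>A\<in>\<F>. t + 1 \<le> card (A \<inter> D)")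
      case False
      then obtain F where F: "F \<in> \<F>" "card (F \<inter> D) \<le> t" by (auto simp: not_le)
      \<comment> \<open>Removing a common point of \<open>F\<close> and \<open>D\<close> lowers the
        intersection below \<open>t\<close>. If there is none, any \<open>j\<close> works because
        \<open>1 \<le> t\<close>.\<close>
      have "\<exists>j\<in>D. card (F \<inter> (D - {j})) < t"
      proof (cases "F \<inter> D = {}")
        case True
        obtain j where "j \<in> D" using 2(2) by fastforce
        moreover have "F \<inter> (D - {j}) = {}" using True by blast
        ultimately show ?thesis using assms(1) by (intro bexI[of _ j]) auto
      next
        case False
        then obtain j where j: "j \<in> F" "j \<in> D" by blast
        have "F \<inter> (D - {j}) \<subset> F \<inter> D" using j by blast
        then have "card (F \<inter> (D - {j})) < card (F \<inter> D)"
          using fD by (intro psubset_card_mono) auto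
        then show ?thesis using F j by (intro bexI[of _ j]) auto
      qed
      then obtain j where j: "j \<in> D" "card (F \<inter> (D - {j})) < t" by blast
      define E where "E = D - {j}"
      have cE: "card E = t + 1" using 2(2) j(1) fD by (simp add: E_def)
      \<comment> \<open>A member that avoids \<open>j\<close> and contains a set of \<open>T\<close>
        must contain \<open>E\<close>. As \<open>F\<close> meets \<open>E\<close> in fewer than
        \<open>t\<close> points, it also contains a point of \<open>F\<close> outside
        \<open>E\<close>, and this point is not \<open>j\<close>.\<close>
      define W' where "W' = (\<lambda>x. insert x E) ` (F - D)"
      define H' where "H' = {A \<in> k_subsets n k. \<exists>Y\<in>W'. Y \<subseteq> A}"
      have W': "W' \<subseteq> Pow {1..n}" using \<F>(1)[OF F(1)] 2(1) by (auto simp: W'_def E_def)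
      have W'c: "card Y = t + 2" if "Y \<in> W'" for Y
        using that cE fD by (auto simp: W'_def E_def)
      have "card W' \<le> k"
        using card_image_le[of "F - D" "\<lambda>x. insert x E"] card_mono[of F "F - D"] \<F>(2,3)[OF F(1)]
        by (simp add: W'_def)
      then have "card {Y \<in> W'. card Y = i} \<le> (if i = t + 2 then k else 0)" for i
        using W'c by (cases "i = t + 2") (simp_all cong: conj_cong)
      then have "card H' \<le> (\<Sum>i = t + 2..k. (if i = t + 2 then k else 0) * ((n - i) choose (k - i)))"
        unfolding H'_def using W' W'c by (intro card_covered_le) auto
      also have "\<dots> = (\<Sum>i = t + 2..k. if i = t + 2 then k * ((n - (t + 2)) choose (k - (t + 2))) else 0)"
        by (intro sum.cong) auto
      also have "\<dots> = (if t + 2 \<le> k then k * ((n - (t + 2)) choose (k - (t + 2))) else 0)"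
        by (simp add: sum.delta)
      finally have H': "card H' \<le> (if t + 2 \<le> k then k * ((n - (t + 2)) choose (k - (t + 2))) else 0)" .
      have "A \<in> H \<union> H'" if A: "A \<in> \<F>" "j \<notin> A" for A
      proof (cases "A \<in> H")
        case False
        then obtain Y where Y: "Y \<in> T" "Y \<subseteq> A" using split A by blast
        have "t + 1 \<le> card (Y \<inter> D)" using 2(3) Y by blast
        moreover have "Y \<inter> D \<subseteq> E" using Y(2) A(2) by (auto simp: E_def)
        ultimately have "Y \<inter> D = E" using cE fD by (intro card_seteq) (auto simp: E_def)
        then have EA: "E \<subseteq> A" using Y(2) by blast
        have "\<not> A \<inter> F \<subseteq> F \<inter> E"
        proof
          assume "A \<inter> F \<subseteq> F \<inter> E"
          then have "card (A \<inter> F) \<le> card (F \<inter> E)"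
            using \<F>(3)[OF F(1)] by (intro card_mono) auto
          moreover have "t \<le> card (A \<inter> F)"
            using assms(4) A F by (simp add: t_intersecting_def)
          ultimately show False using j(2) by (simp add: E_def)
        qed
        then obtain x where x: "x \<in> A" "x \<in> F" "x \<notin> E" by blast
        then have "insert x E \<in> W'" using A(2) by (auto simp: W'_def E_def)
        moreover have "insert x E \<subseteq> A" using EA x by blast
        ultimately have "\<exists>Y\<in>W'. Y \<subseteq> A" by (rule bexI[rotated])
        then show ?thesis using A(1) assms(3) by (auto simp: H'_def)
      qed blast
      then have "{A \<in> \<F>. j \<notin> A} \<subseteq> H \<union> H'" by blast
      then have "card {A \<in> \<F>. j \<notin> A} \<le> card (H \<union> H')"
        using finH by (intro card_mono) (auto simp: H'_def finite_k_subsets)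
      also have "\<dots> \<le> card H + card H'" by (rule card_Un_le)
      finally show ?thesis using H H' j(1) 2(1) by (intro disjI1 bexI[of _ j]) (linarith, blast)
    qed (use 2 in blast)
  qed
qed

section \<open>Comparison with the binomial bound\<close>

theorem theorem1p7:
  fixes n k t :: nat and \<F> :: "nat set set"
  assumes "1 \<le> t"
    and "2 \<le> n"
    and "\<F> \<subseteq> k_subsets n k"
    and "t_intersecting t \<F>"
    and "n \<ge> 2 * (t + 3)^2 * k^2"
  shows "sturdiness n \<F> \<le> binom (int n - int t - 3) (int k - int t - 2)"
proof -
  have binom_eq: "binom (int n - int t - 3) (int k - int t - 2) =
      (if t + 2 \<le> k then (n - (t + 3)) choose (k - (t + 2)) else 0)"
  proof -
    have "nat (int n - int t - 3) = n - (t + 3)" "nat (int k - int t - 2) = k - (t + 2)"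
      by linarith+
    then show ?thesis by (auto simp: binom_def)
  qed
  have "16 \<le> (t + 3)\<^sup>2"
    using power_mono[of 4 "t + 3" 2] assms(1) by simp
  then have "32 * k\<^sup>2 \<le> n"
    using assms(5) mult_right_mono[of 32 "2 * (t + 3)\<^sup>2" "k\<^sup>2"] by linarith
  moreover have "k \<le> k\<^sup>2" by (simp add: power2_eq_square)
  \<comment> \<open>The first bound is equivalent to
    \<open>n + 2 * k\<^sup>2 \<le> 2 * (n - k)\<close>, the form used below.\<close>
  ultimately have nk: "2 * k\<^sup>2 + 2 * k \<le> n" "4 * k \<le> n" by linarith+
  consider j where "j \<in> {1..n}" "card {A \<in> \<F>. j \<notin> A} \<le>
      (\<Sum>i = t + 2..k. (i choose t) * (i - t + 1) ^ (i - t) * ((n - i) choose (k - i))) +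
      (if t + 2 \<le> k then k * ((n - (t + 2)) choose (k - (t + 2))) else 0)"
    | D where "D \<subseteq> {1..n}" "card D = t + 2" "\<forall>A\<in>\<F>. t + 1 \<le> card (A \<inter> D)"
    using few_avoiding_or_concentrated[OF assms(1) _ assms(3,4)] assms(2) by fastforce
  then show ?thesis
  proof cases
    case 1
    show ?thesis
    proof (cases "t + 2 \<le> k")
      case True
      define S where "S = (\<Sum>i = t + 2..k. (i choose t) * (i - t + 1) ^ (i - t) * ((n - i) choose (k - i)))"
      define C where "C = (n - (t + 2)) choose (k - (t + 2))"
      define N where "N = (n - (t + 3)) choose (k - (t + 2))"
      have "(n - 1) * sturdiness n \<F> \<le> k * card {A \<in> \<F>. j \<notin> A}"
        by (rule sturdiness_mult_le[OF assms(3) 1(1)])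
      also have "\<dots> \<le> k * (S + k * C)"
        using 1(2) True by (intro mult_left_mono) (simp_all add: S_def C_def)
      also have "2 * \<dots> = 2 * k * S + 2 * k\<^sup>2 * C"
        by (simp add: power2_eq_square algebra_simps)
      also have "2 * k * S \<le> n * C"
        using level_weight_sum_le[OF True assms(5)] by (simp only: S_def C_def)
      finally have "2 * ((n - 1) * sturdiness n \<F>) \<le> (n + 2 * k\<^sup>2) * C"
        by (simp add: algebra_simps)
      also have "\<dots> \<le> 2 * (n - k) * C"
        using nk by (intro mult_right_mono) linarith+
      finally have "(n - 1) * sturdiness n \<F> \<le> (n - k) * C" by simp
      \<comment> \<open>By absorption \<open>C\<close> exceeds the target \<open>N\<close> by the
        factor \<open>(n - (t + 2)) / (n - k)\<close>. The averaging bound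
        \<open>(n - k) / (n - 1) * C\<close> is therefore at most \<open>N\<close>.\<close>
      then have "(n - (t + 2)) * ((n - 1) * sturdiness n \<F>) \<le> (n - 1) * ((n - k) * C)"
        by - (rule mult_le_mono, simp_all)
      also have "(n - k) * C = (n - (t + 2)) * N"
      proof -
        have "n - (t + 2) - (k - (t + 2)) = n - k" "n - (t + 2) - 1 = n - (t + 3)"
          using True by linarith+
        then show ?thesis
          using binomial_absorb_comp[of "n - (t + 2)" "k - (t + 2)"] by (simp only: C_def N_def)
      qed
      finally have "((n - 1) * (n - (t + 2))) * sturdiness n \<F> \<le> ((n - 1) * (n - (t + 2))) * N"
        by (simp only: mult_ac)
      moreover have "0 < (n - 1) * (n - (t + 2))" using True nk by simp
      ultimately have "sturdiness n \<F> \<le> N" by (rule mult_left_le_imp_le)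
      then show ?thesis using True by (simp add: binom_eq N_def)
    next
      case False
      \<comment> \<open>For \<open>k < t + 2\<close> the sum is empty, so no member avoids
        \<open>j\<close> and every \<open>b_count \<F> i j\<close> vanishes.\<close>
      obtain i where i: "i \<in> {1..n}" "i \<noteq> j"
        using assms(2) by (cases "j = 1") (auto intro: that[of 1] that[of 2])
      have fin: "finite \<F>" using assms(3) finite_k_subsets finite_subset by blast
      have "sturdiness n \<F> \<le> b_count \<F> i j" using i 1(1) by (intro sturdiness_le_b_count)
      also have "\<dots> \<le> card {A \<in> \<F>. j \<notin> A}"
        unfolding b_count_def using fin by (intro card_mono) auto
      also have "\<dots> \<le> 0" using 1(2) False by simp
      finally show ?thesis by simp
    qed
  next
    case 2
    have fD: "finite D" using 2(1) finite_subset by blast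
    show ?thesis
    proof (cases "\<F> = {}")
      case True
      then show ?thesis
        using sturdiness_le_b_count[of 1 n 2 \<F>] assms(2) by (simp add: b_count_def)
    next
      case False
      then obtain A where A: "A \<in> \<F>" by blast
      then have "finite A" "card A = k"
        using assms(3) by (auto simp: k_subsets_def intro: finite_subset)
      \<comment> \<open>A member forces \<open>t + 1 \<le> k\<close>, and
        \<open>4 * k \<le> n\<close> then leaves a point outside \<open>D\<close>.\<close>
      then have "t + 1 \<le> k" using 2(3) A card_mono[of A "A \<inter> D"] by fastforce
      then have "card D < card {1..n}" using nk(2) 2(2) assms(1) by simp
      then obtain i where i: "i \<in> {1..n}" "i \<notin> D"
        by (metis card_mono fD not_le subsetI)
      obtain j where j: "j \<in> D" using 2(2) by fastforce
      \<comment> \<open>A member containing \<open>i\<close> but not \<open>j\<close> includes the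
        other \<open>t + 1\<close> points of \<open>D\<close>, hence \<open>Z\<close>. Only the
        \<open>n - 1\<close> points other than \<open>j\<close> are available to it, so the upper
        index is \<open>n - 1 - (t + 2)\<close>.\<close>
      define Z where "Z = insert i (D - {j})"
      have cZ: "card Z = t + 2" using i j fD 2(2) by (simp add: Z_def)
      have sub: "{A \<in> \<F>. i \<in> A \<and> j \<notin> A} \<subseteq> {A. A \<subseteq> {1..n} - {j} \<and> card A = k \<and> Z \<subseteq> A}"
      proof
        fix B assume B: "B \<in> {A \<in> \<F>. i \<in> A \<and> j \<notin> A}"
        have "B \<inter> D \<subseteq> D - {j}" using B by blast
        moreover have "card (D - {j}) \<le> card (B \<inter> D)" using B 2 j fD by simp
        ultimately have "B \<inter> D = D - {j}" using fD by (intro card_seteq) auto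
        then show "B \<in> {A. A \<subseteq> {1..n} - {j} \<and> card A = k \<and> Z \<subseteq> A}"
          using B assms(3) by (auto simp: k_subsets_def Z_def)
      qed
      have "sturdiness n \<F> \<le> b_count \<F> i j"
        using i j 2(1) by (intro sturdiness_le_b_count) auto
      also have "\<dots> \<le> card {A. A \<subseteq> {1..n} - {j} \<and> card A = k \<and> Z \<subseteq> A}"
        unfolding b_count_def by (intro card_mono sub) simp
      also have "\<dots> \<le> (if t + 2 \<le> k then (n - (t + 3)) choose (k - (t + 2)) else 0)"
      proof (cases "t + 2 \<le> k")
        case True
        have "Z \<subseteq> {1..n} - {j}" using i j 2(1) by (auto simp: Z_def)
        moreover have "card ({1..n} - {j}) = n - 1" using j 2(1) by auto
        ultimately show ?thesis
          using card_supersets_le[of "{1..n} - {j}" Z k] cZ True by (simp add: numeral_3_eq_3)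
      next
        case False
        have "\<not> (A \<subseteq> {1..n} - {j} \<and> card A = k \<and> Z \<subseteq> A)" for A
          using cZ False card_mono[of A Z] finite_subset[of A "{1..n} - {j}"] by auto
        then have "{A. A \<subseteq> {1..n} - {j} \<and> card A = k \<and> Z \<subseteq> A} = {}" by blast
        then show ?thesis by (simp only: card.empty le0)
      qed
      finally show ?thesis by (simp only: binom_eq)
    qed
  qed
qed

end
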